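(* Let $\mathcal{X},\mathcal{Y},\mathfrak{B},\mathcal{R},\mathcal{F},\varphi^\dagger,\varphi^\dagger_*,\Delta$, the estimators $\widehat{\mathcal{F}}_n:\mathfrak{B}\to\widehat{\mathcal{Y}}_n$, the function $\Lambda$, the initial guess $\varphi_0$ and the regularization parameters $(\alpha_k)$ be as in the context. Let the variational source condition $$\langle\varphi^\dagger_*,\varphi^\dagger-\varphi\rangle\le\beta\,\Delta(\varphi,\varphi^\dagger)^{1/2}\,\Lambda\!\left(\frac{\|\mathcal{F}'[\varphi^\dagger](\varphi-\varphi^\dagger)\|^2}{\Delta(\varphi,\varphi^\dagger)}\right)\qquad\text{for all }\varphi\in\mathfrak{B}$$ hold true, for some constant $\beta$, with a concave $\Lambda$ for which $t\mapsto\sqrt{t}/\Lambda(t)$ is monotonically increasing. Assume that the sequence $\widehat{\mathcal{F}}_n$ has the following convergence properties: (a) $\|\widehat{\mathcal{F}}_n(\varphi^\dagger)\|=O_p(\delta_n)$; (b) $\displaystyle\left(\left|\sup_{\varphi\in\mathfrak{B},\ \Delta(\varphi,\varphi^\dagger)\ne 0}\frac{\|\mathcal{F}'[\varphi^\dagger](\varphi-\varphi^\dagger)\|^2-\|\widehat{\mathcal{F}}_n'[\varphi^\dagger](\varphi-\varphi^\dagger)\|^2}{\Delta(\varphi,\varphi^\dagger)}\right|\right)^{1/2}=O_p(\gamma_n)$; (c) $\displaystyle P\Big\{\|\widehat{\mathcal{F}}_n(\varphi_1)-\widehat{\mathcal{F}}_n(\varphi_2)-\widehat{\mathcal{F}}_n'[\varphi_2](\varphi_1-\varphi_2)\|>\eta\,\|\widehat{\mathcal{F}}_n(\varphi_1)-\widehat{\mathcal{F}}_n(\varphi_2)\|\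 \text{for some }\varphi_1,\varphi_2\in\mathfrak{B}\Big\}\to 0$. Here $\eta$ must be sufficiently small, such that $4\eta(1+\eta)(1-\eta)^{-3}<q^{-3/2}$, with $q$ as below. Suppose that the convex minimization problems $$\widehat\varphi_k:=\operatorname*{argmin}_{\varphi\in\mathfrak{B}}\Big[\|\widehat{\mathcal{F}}_n'[\widehat\varphi_{k-1}](\varphi-\widehat\varphi_{k-1})+\widehat{\mathcal{F}}_n(\widehat\varphi_{k-1})\|^2+\alpha_k\mathcal{R}(\varphi)\Big],\qquad \widehat\varphi_0=\varphi_0,$$ are uniquely solvable for every $\widehat{\mathcal{F}}_n$, i.e. the method is well defined. Put $\Theta(t):=\sqrt{t}\,\Lambda(t)$. Further assume that $\alpha_0>\max(\Theta^{-1}(\delta_n),\gamma_n^2)$ and that $\alpha_k\le q\,\alpha_{k+1}$ for all $k$ with a constant $q>1$. Let the iteration be stopped at the smallest index $K_n\in\mathbb{N}_0$ for which $$\alpha_{K_n+1}\le\max(\Theta^{-1}(\delta_n),\gamma_n^2).$$ Then $$\Delta(\widehat\varphi_{K_n},\varphi^\dagger)=O_p\Big(\Lambda^2\big(\max(\Theta^{-1}(\delta_n),\gamma_n^2)\big)\Big).$$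
   Context: Setting. $\mathcal{X}$ is a Banach space with dual $\mathcal{X}'$ and dual pairing $\langle\cdot,\cdot\rangle$, $\mathcal{Y}$ is a Hilbert space, $\mathfrak{B}\subset\mathcal{X}$ is convex, and $\varphi^\dagger\in\mathfrak{B}$ is a root of the operator $\mathcal{F}:\mathfrak{B}\to\mathcal{Y}$, i.e. $\mathcal{F}(\varphi^\dagger)=0$. The penalty functional $\mathcal{R}:\mathfrak{B}\to(-\infty,\infty]$ is convex, lower semi-continuous and not identically equal to $\infty$. Bregman distance. $\varphi^\dagger_*\in\partial\mathcal{R}(\varphi^\dagger)$ is a fixed element of the subdifferential of $\mathcal{R}$ at $\varphi^\dagger$, and $\Delta(\varphi,\varphi^\dagger):=\mathcal{R}(\varphi)-\mathcal{R}(\varphi^\dagger)-\langle\varphi^\dagger_*,\varphi-\varphi^\dagger\rangle$. The Bregman distance $\Delta(\tilde\varphi,\varphi)$ at another base point $\varphi$ is defined in the same way. Estimated operators. $\mathcal{F}$ is approximated by a sequence of estimators $\widehat{\mathcal{F}}_n:\mathfrak{B}\to\widehat{\mathcal{Y}}_n$ mapping to some (possibly finite-dimensional and/or data-dependent) Hilbert spaces $\widehat{\mathcal{Y}}_n$. $\mathcal{F}$ and all $\widehat{\mathcal{F}}_n$ are Gateaux differentiable on $\mathfrak{B}$ with linear derivatives $\mathcal{F}'[\varphi]$ and $\widehat{\mathcal{F}}_n'[\varphi]$, which are bounded with respect to $\Delta$ in the sense that $\sup_{\{\tilde\varphi\in\mathfrak{B}:\Delta(\tilde\varphi,\varphi)\ne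 0\}}\|\mathcal{F}'[\varphi](\tilde\varphi-\varphi)\|^2/\Delta(\tilde\varphi,\varphi)<\infty$, and $\mathcal{F}'[\varphi](\tilde\varphi-\varphi)\neq 0$ whenever $\Delta(\tilde\varphi,\varphi)\ne 0$, and analogously for all $\widehat{\mathcal{F}}_n$. Norms are those of the respective Hilbert spaces. $\Lambda:[0,\infty)\to[0,\infty)$ is a continuous, strictly monotonically increasing function with $\Lambda(0)=0$. $\varphi_0$ is the initial guess at which the iteration is started, and $(\alpha_k)$ is a sequence of (positive) regularization parameters tending to $0$. The iterates $\widehat\varphi_k$ depend on $n$ through $\widehat{\mathcal{F}}_n$. $O_p$ denotes stochastic boundedness as $n\to\infty$: $X_n=O_p(a_n)$ means that for every $\varepsilon>0$ there is $M$ such that $P(|X_n|>Ma_n)\le\varepsilon$ for all sufficiently large $n$.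
   Formalization: Added assumptions, without which the claim fails: the norm of F̂_n(φ_0) is O_p(1), and R(φ_0) is finite whenever K_n = 0 for large n; "η sufficiently small" is read as including 0 ≤ η < 1. *)

theory Defs
  imports "HOL-Probability.Probability"
begin

(* The image spaces of the estimators vary with n and with the data, so they cannot be types:
   such a Hilbert space is a subspace H of a real vector space together with an inner product
   that is only meaningful on H. *)

definition hnorm :: "('z \<Rightarrow> 'z \<Rightarrow> real) \<Rightarrow> 'z \<Rightarrow> real" where
  "hnorm ip v = sqrt (ip v v)"

definition hilbert_on :: "'z::real_vector set \<Rightarrow> ('z \<Rightarrow> 'z \<Rightarrow> real) \<Rightarrow> bool" where
  "hilbert_on H ip \<longleftrightarrow>
     subspace H \<and>
     (\<forall>x\<in>H. \<forall>y\<in>H. ip x y = ip y x) \<and>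
     (\<forall>x\<in>H. \<forall>y\<in>H. \<forall>z\<in>H. ip (x + y) z = ip x z + ip y z) \<and>
     (\<forall>c. \<forall>x\<in>H. \<forall>y\<in>H. ip (c *\<^sub>R x) y = c * ip x y) \<and>
     (\<forall>x\<in>H. x \<noteq> 0 \<longrightarrow> 0 < ip x x) \<and>
     Metric_space.mcomplete H (\<lambda>x y. hnorm ip (x - y))"

definition proper_convex_lsc :: "'x::real_normed_vector set \<Rightarrow> ('x \<Rightarrow> ereal) \<Rightarrow> bool" where
  "proper_convex_lsc B R \<longleftrightarrow>
     (\<forall>x\<in>B. R x \<noteq> -\<infinity>) \<and> (\<exists>x\<in>B. R x \<noteq> \<infinity>) \<and>
     (\<forall>x\<in>B. \<forall>y\<in>B. \<forall>t\<in>{0..1}.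
        R ((1 - t) *\<^sub>R x + t *\<^sub>R y) \<le> ereal (1 - t) * R x + ereal t * R y) \<and>
     (\<forall>x\<in>B. R x \<le> Liminf (at x within B) R)"

definition subdifferential ::
    "'x::real_normed_vector set \<Rightarrow> ('x \<Rightarrow> ereal) \<Rightarrow> 'x \<Rightarrow> ('x \<Rightarrow>\<^sub>L real) set" where
  "subdifferential B R x = {\<xi>. \<forall>y\<in>B. R x + ereal (blinfun_apply \<xi> (y - x)) \<le> R y}"

definition bregman ::
    "('x::real_normed_vector \<Rightarrow> ereal) \<Rightarrow> ('x \<Rightarrow>\<^sub>L real) \<Rightarrow> 'x \<Rightarrow> 'x \<Rightarrow> ereal" where
  "bregman R \<xi> y x = R y - R x - ereal (blinfun_apply \<xi> (y - x))"

(* Since B need not have interior points, the derivative at x is tested on the directions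
   y - x with y in B.  N is the norm of the image space. *)

definition gateaux_on ::
    "'x::real_vector set \<Rightarrow> ('z::real_vector \<Rightarrow> real) \<Rightarrow> ('x \<Rightarrow> 'z) \<Rightarrow> ('x \<Rightarrow> 'x \<Rightarrow> 'z) \<Rightarrow> bool" where
  "gateaux_on B N F F' \<longleftrightarrow>
     (\<forall>x\<in>B. linear (F' x) \<and>
       (\<forall>y\<in>B. ((\<lambda>t. N ((1 / t) *\<^sub>R (F (x + t *\<^sub>R (y - x)) - F x) - F' x (y - x))) \<longlongrightarrow> 0)
               (at_right 0)))"

(* sg selects a subgradient at every base point that has one; at the other base points the
   Bregman distance is undefined.  Where the distance is infinite the quotient is 0. *)

definition bregman_bounded_on ::
    "'x::real_normed_vector set \<Rightarrow> ('x \<Rightarrow> ereal) \<Rightarrow> ('x \<Rightarrow> ('x \<Rightarrow>\<^sub>L real)) \<Rightarrow>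
     ('z::real_vector \<Rightarrow> real) \<Rightarrow> ('x \<Rightarrow> 'x \<Rightarrow> 'z) \<Rightarrow> bool" where
  "bregman_bounded_on B R sg N F' \<longleftrightarrow>
     (\<forall>x\<in>B. subdifferential B R x \<noteq> {} \<longrightarrow>
        (SUP y\<in>{y\<in>B. bregman R (sg x) y x \<noteq> 0}.
           ereal ((N (F' x (y - x)))\<^sup>2) / bregman R (sg x) y x) < \<infinity> \<and>
        (\<forall>y\<in>B. bregman R (sg x) y x \<noteq> 0 \<longrightarrow> F' x (y - x) \<noteq> 0))"

definition gn_functional ::
    "('x::real_vector \<Rightarrow> ereal) \<Rightarrow> ('z::real_vector \<Rightarrow> real) \<Rightarrow> ('x \<Rightarrow> 'z) \<Rightarrow> ('x \<Rightarrow> 'x \<Rightarrow> 'z) \<Rightarrow>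
     real \<Rightarrow> 'x \<Rightarrow> 'x \<Rightarrow> ereal" where
  "gn_functional R N F F' a x y = ereal ((N (F' x (y - x) + F x))\<^sup>2) + ereal a * R y"

primrec gn_iterate ::
    "'x::real_vector set \<Rightarrow> ('x \<Rightarrow> ereal) \<Rightarrow> ('z::real_vector \<Rightarrow> real) \<Rightarrow> ('x \<Rightarrow> 'z) \<Rightarrow>
     ('x \<Rightarrow> 'x \<Rightarrow> 'z) \<Rightarrow> (nat \<Rightarrow> real) \<Rightarrow> 'x \<Rightarrow> nat \<Rightarrow> 'x" where
  "gn_iterate B R N F F' \<alpha> x0 0 = x0"
| "gn_iterate B R N F F' \<alpha> x0 (Suc k) =
     arg_min_on (gn_functional R N F F' (\<alpha> (Suc k)) (gn_iterate B R N F F' \<alpha> x0 k)) B"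

(* Outer probability is used because the events need not be measurable (they involve suprema and
   unions over B); it equals the probability on measurable events. *)

definition stoch_bounded :: "'w measure \<Rightarrow> (nat \<Rightarrow> 'w \<Rightarrow> ereal) \<Rightarrow> (nat \<Rightarrow> real) \<Rightarrow> bool" where
  "stoch_bounded P X a \<longleftrightarrow>
     (\<forall>\<epsilon>>0. \<exists>M. \<forall>\<^sub>F n in sequentially.
        outer_measure_of P {\<omega> \<in> space P. ereal (M * a n) < \<bar>X n \<omega>\<bar>} \<le> ennreal \<epsilon>)"

definition Theta :: "(real \<Rightarrow> real) \<Rightarrow> real \<Rightarrow> real" where
  "Theta \<Lambda> t = sqrt t * \<Lambda> t"

definition noise_level :: "(real \<Rightarrow> real) \<Rightarrow> real \<Rightarrow> real \<Rightarrow> real" where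
  "noise_level \<Lambda> d g = max (the_inv_into {0..} (Theta \<Lambda>) d) (g\<^sup>2)"

end

(* Write e_k for the norm of Fh(phi_k) - Fh(phi_dagger), D_k for the Bregman distance of phi_k and
   T_k = Theta(alpha_k).  With probability close to one the tangential cone condition holds and all
   stochastic errors are at most M times their rates, which are in turn dominated by T_k (for
   delta_n) and alpha_k (for gamma_n^2) up to the stopping index.  Comparing the k-th functional at
   phi_k and at phi_dagger then gives
     lin^2 + alpha_k D_k <= (eta e_{k-1} + M T_k)^2 + alpha_k (source term),
     lin >= (1 - eta) e_k - eta e_{k-1} - M T_k.
   Since sqrt t / Lambda t increases, Lambda t <= (1 + sqrt (t / alpha_k)) Lambda(alpha_k), so the
   source term is at most T_k times a linear expression in sqrt (alpha_k D_k) and e_k.  Absorbing it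
   leaves (1 - eta - eps) e_k <= 2 eta e_{k-1} + const T_k, and T_{k-1} <= q T_k.  As
   2 eta q < 1 - eta, induction yields e_k <= E T_k, whence D_k <= C Lambda(alpha_k)^2. *)

theory Submission
  imports Defs
begin

section \<open>Union bound for outer probability\<close>

text \<open>Measurable hulls of the same measure reduce the claim to subadditivity on measurable
  sets. It serves to add up exceptional events that need not be measurable.\<close>

lemma outer_measure_of_Un_le:
  assumes "A \<subseteq> space M" "B \<subseteq> space M"
  shows "outer_measure_of M (A \<union> B) \<le> outer_measure_of M A + outer_measure_of M B"
proof -
  obtain C where C: "C \<in> sets M" "A \<subseteq> C" "outer_measure_of M A = emeasure M C"
    using outer_measure_of_attain[OF assms(1)] by auto
  obtain D where D: "D \<in> sets M" "B \<subseteq> D" "outer_measure_of M B = emeasure M D"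
    using outer_measure_of_attain[OF assms(2)] by auto
  have "outer_measure_of M (A \<union> B) \<le> outer_measure_of M (C \<union> D)"
    using C D by (intro outer_measure_of_mono) auto
  also have "\<dots> = emeasure M (C \<union> D)"
    using C D by simp
  also have "\<dots> \<le> emeasure M C + emeasure M D"
    using C D by (intro emeasure_subadditive)
  finally show ?thesis
    using C D by simp
qed

subsection \<open>Hilbert spaces with an explicit inner product\<close>

lemma hilbert_on_simps:
  assumes "hilbert_on H ip" "x \<in> H" "y \<in> H"
  shows hilbert_on_add: "ip (x + y) (x + y) = ip x x + 2 * ip x y + ip y y"
    and hilbert_on_scaleR: "ip (c *\<^sub>R x) (c *\<^sub>R x) = c\<^sup>2 * ip x x"
    and hilbert_on_nonneg: "0 \<le> ip x x"
    and hilbert_on_scaleR_right: "ip x (c *\<^sub>R y) = c * ip x y"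
proof -
  have sub: "subspace H"
    and sym: "\<And>x y. x \<in> H \<Longrightarrow> y \<in> H \<Longrightarrow> ip x y = ip y x"
    and add: "\<And>x y z. x \<in> H \<Longrightarrow> y \<in> H \<Longrightarrow> z \<in> H \<Longrightarrow> ip (x + y) z = ip x z + ip y z"
    and scale: "\<And>c x y. x \<in> H \<Longrightarrow> y \<in> H \<Longrightarrow> ip (c *\<^sub>R x) y = c * ip x y"
    and pos: "\<And>x. x \<in> H \<Longrightarrow> x \<noteq> 0 \<Longrightarrow> 0 < ip x x"
    using assms(1) unfolding hilbert_on_def by blast+
  have mem: "x + y \<in> H" "c *\<^sub>R x \<in> H" "c *\<^sub>R y \<in> H" "0 \<in> H"
    using sub assms by (auto simp: subspace_add subspace_scale subspace_0)
  show "ip (x + y) (x + y) = ip x x + 2 * ip x y + ip y y"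
    using add[of x y "x + y"] sym[of x "x + y"] sym[of y "x + y"] add[of x y x] add[of x y y]
      sym[of x y] mem assms by simp
  show "ip (c *\<^sub>R x) (c *\<^sub>R x) = c\<^sup>2 * ip x x"
    using scale[of x "c *\<^sub>R x" c] sym[of x "c *\<^sub>R x"] scale[of x x c] mem assms
    by (simp add: power2_eq_square)
  show "ip x (c *\<^sub>R y) = c * ip x y"
    using sym[of x "c *\<^sub>R y"] scale[of y x c] sym[of x y] mem assms by simp
  have "ip 0 0 = 0"
    using scale[of 0 0 0] mem by simp
  then show "0 \<le> ip x x"
    using pos[of x] assms by (cases "x = 0") auto
qed

lemma hnorm_nonneg: "hilbert_on H ip \<Longrightarrow> x \<in> H \<Longrightarrow> 0 \<le> hnorm ip x"
  by (simp add: hnorm_def hilbert_on_nonneg)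

lemma hnorm_minus:
  assumes "hilbert_on H ip" "x \<in> H"
  shows "hnorm ip (- x) = hnorm ip x"
  using hilbert_on_scaleR[OF assms assms(2), of "-1"] by (simp add: hnorm_def)

text \<open>Discriminant argument: the squared norm of \<open>x + c *\<^sub>R y\<close> is a
  nonnegative quadratic polynomial in \<open>c\<close>.\<close>

lemma hilbert_on_Cauchy_Schwarz:
  assumes "hilbert_on H ip" "x \<in> H" "y \<in> H"
  shows "(ip x y)\<^sup>2 \<le> ip x x * ip y y"
proof -
  have sub: "subspace H"
    using assms(1) by (simp add: hilbert_on_def)
  have quad: "0 \<le> ip x x + 2 * (c * ip x y) + c\<^sup>2 * ip y y" for c
  proof -
    have mem: "c *\<^sub>R y \<in> H" "x + c *\<^sub>R y \<in> H"
      using sub assms by (auto simp: subspace_add subspace_scale)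
    have "0 \<le> ip (x + c *\<^sub>R y) (x + c *\<^sub>R y)"
      using hilbert_on_nonneg[OF assms(1) mem(2) mem(2)] .
    also have "\<dots> = ip x x + 2 * (c * ip x y) + c\<^sup>2 * ip y y"
      using hilbert_on_add[OF assms(1,2) mem(1)] hilbert_on_scaleR_right[OF assms]
        hilbert_on_scaleR[OF assms(1,3,3)] by simp
    finally show ?thesis .
  qed
  show ?thesis
  proof (cases "ip y y = 0")
    case True
    have "ip x y = 0"
    proof (rule ccontr)
      assume "ip x y \<noteq> 0"
      \<comment> \<open>The polynomial is now affine in \<open>c\<close>, and this \<open>c\<close>
        gives it the value -1.\<close>
      with quad[of "- (ip x x + 1) / (2 * ip x y)"] True show False by (simp add: field_simps)
    qed
    with True show ?thesis by simp
  next
    case False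
    then have pos: "0 < ip y y"
      using hilbert_on_nonneg[OF assms(1,3,3)] by simp
    \<comment> \<open>The polynomial is evaluated at its minimizer.\<close>
    have "0 \<le> ip x x - (ip x y)\<^sup>2 / ip y y"
      using quad[of "- ip x y / ip y y"] pos by (simp add: power2_eq_square field_simps)
    then show ?thesis
      using pos by (simp add: field_simps)
  qed
qed

lemma hnorm_triangle_ineq:
  assumes "hilbert_on H ip" "x \<in> H" "y \<in> H"
  shows "hnorm ip (x + y) \<le> hnorm ip x + hnorm ip y"
proof -
  have nn: "0 \<le> ip x x" "0 \<le> ip y y"
    using hilbert_on_nonneg assms by blast+
  have "ip x y \<le> \<bar>ip x y\<bar>" by simp
  also have "\<dots> \<le> sqrt (ip x x * ip y y)"
    using hilbert_on_Cauchy_Schwarz[OF assms] by (intro real_le_rsqrt) simp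
  finally have "ip (x + y) (x + y) \<le> (sqrt (ip x x) + sqrt (ip y y))\<^sup>2"
    using nn by (simp add: hilbert_on_add[OF assms] power2_sum real_sqrt_mult)
  then show ?thesis
    using nn by (simp add: hnorm_def real_le_lsqrt)
qed

subsection \<open>The index function\<close>

locale source_function =
  fixes \<Lambda> :: "real \<Rightarrow> real"
  assumes continuous: "continuous_on {0..} \<Lambda>"
    and strict_mono: "strict_mono_on {0..} \<Lambda>"
    and zero: "\<Lambda> 0 = 0"
    and sqrt_div_mono: "mono_on {0<..} (\<lambda>t. sqrt t / \<Lambda> t)"
begin

lemma mono: "0 \<le> s \<Longrightarrow> s \<le> t \<Longrightarrow> \<Lambda> s \<le> \<Lambda> t"
  using strict_mono by (cases "s = t") (auto simp: strict_mono_on_def less_le)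

lemma pos: "0 < t \<Longrightarrow> 0 < \<Lambda> t"
  using strict_mono_onD[OF strict_mono, of 0 t] zero by simp

lemma nonneg: "0 \<le> t \<Longrightarrow> 0 \<le> \<Lambda> t"
  using pos zero by (cases "t = 0") (auto simp: less_le)

text \<open>Rearranged monotonicity of \<open>sqrt t / \<Lambda> t\<close>: beyond \<open>a\<close>
  the growth is at most that of a square root.\<close>

lemma le_sqrt_ratio:
  assumes "0 < a" "a \<le> t"
  shows "\<Lambda> t \<le> sqrt (t / a) * \<Lambda> a"
proof -
  have "sqrt a / \<Lambda> a \<le> sqrt t / \<Lambda> t"
    using sqrt_div_mono assms by (auto simp: mono_on_def)
  then show ?thesis
    using pos[of a] pos[of t] assms by (simp add: field_simps real_sqrt_divide)
qed

text \<open>Joins the regimes \<open>t < a\<close> and \<open>a \<le> t\<close> in one bound that is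
  affine in \<open>sqrt t\<close>. This is what makes the source term linear in the unknown
  quantities.\<close>

lemma le_one_plus_sqrt_ratio:
  assumes "0 < a" "0 \<le> t"
  shows "\<Lambda> t \<le> (1 + sqrt (t / a)) * \<Lambda> a"
proof (cases "a \<le> t")
  case True
  then show ?thesis
    using le_sqrt_ratio[OF assms(1) True] nonneg[of a] assms by (simp add: algebra_simps)
next
  case False
  have "\<Lambda> t \<le> 1 * \<Lambda> a"
    using False mono[of t a] assms by simp
  also have "\<dots> \<le> (1 + sqrt (t / a)) * \<Lambda> a"
    using assms nonneg[of a] by (intro mult_right_mono) auto
  finally show ?thesis .
qed

lemma Theta_strict_mono: "strict_mono_on {0..} (Theta \<Lambda>)"
proof (rule strict_mono_onI)
  fix s t :: real
  assume st: "s \<in> {0..}" "t \<in> {0..}" "s < t"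
  have "sqrt s * \<Lambda> s \<le> sqrt s * \<Lambda> t"
    using st mono[of s t] by (intro mult_left_mono) auto
  also have "\<dots> < sqrt t * \<Lambda> t"
    using st pos[of t] by (intro mult_strict_right_mono) auto
  finally show "Theta \<Lambda> s < Theta \<Lambda> t"
    by (simp add: Theta_def)
qed

lemma Theta_mono: "0 \<le> s \<Longrightarrow> s \<le> t \<Longrightarrow> Theta \<Lambda> s \<le> Theta \<Lambda> t"
  using Theta_strict_mono by (cases "s = t") (auto simp: strict_mono_on_def less_le)

lemma Theta_pos: "0 < t \<Longrightarrow> 0 < Theta \<Lambda> t"
  by (simp add: Theta_def pos)

text \<open>The root and \<open>\<Lambda>\<close> contribute a factor \<open>sqrt q\<close> each.
  Hence passing to the next regularization parameter costs at most a factor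
  \<open>q\<close>.\<close>

lemma Theta_le_mult:
  assumes "0 < t" "1 \<le> q"
  shows "Theta \<Lambda> (q * t) \<le> q * Theta \<Lambda> t"
proof -
  have "\<Lambda> (q * t) \<le> sqrt q * \<Lambda> t"
    using le_sqrt_ratio[of t "q * t"] assms by simp
  then have "sqrt (q * t) * \<Lambda> (q * t) \<le> sqrt (q * t) * (sqrt q * \<Lambda> t)"
    using assms by (intro mult_left_mono) auto
  also have "\<dots> = q * (sqrt t * \<Lambda> t)"
    using assms by (simp add: real_sqrt_mult)
  finally show ?thesis
    by (simp add: Theta_def)
qed

lemma Theta_surj:
  assumes "0 \<le> d"
  shows "\<exists>t\<ge>0. Theta \<Lambda> t = d"
proof -
  \<comment> \<open>Right end for the intermediate value theorem: \<open>1 \<le> b\<close> gives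
    \<open>\<Lambda> 1 \<le> \<Lambda> b\<close>, and the square gives
    \<open>d \<le> sqrt b * \<Lambda> 1\<close>.\<close>
  define b where "b = max 1 ((d / \<Lambda> 1)\<^sup>2)"
  have b: "1 \<le> b" "d / \<Lambda> 1 \<le> sqrt b"
    using real_sqrt_le_mono[of "(d / \<Lambda> 1)\<^sup>2" b] abs_ge_self[of "d / \<Lambda> 1"]
    by (auto simp: b_def simp del: abs_divide)
  have "d \<le> sqrt b * \<Lambda> 1"
    using b pos[of 1] by (simp add: field_simps)
  also have "\<dots> \<le> sqrt b * \<Lambda> b"
    using b mono[of 1 b] by (intro mult_left_mono) auto
  finally have "d \<le> Theta \<Lambda> b"
    by (simp add: Theta_def)
  moreover have "continuous_on {0..b} (Theta \<Lambda>)"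
    unfolding Theta_def
    by (intro continuous_intros continuous_on_subset[OF continuous]) auto
  ultimately show ?thesis
    using IVT'[of "Theta \<Lambda>" 0 d b] assms b by (auto simp: Theta_def)
qed

text \<open>\<open>the_inv_into\<close> is a genuine inverse here, since
  \<open>Theta \<Lambda>\<close> is injective on the half-line and takes every nonnegative
  value.\<close>

lemma noise_level_bounds:
  assumes "0 \<le> d" "noise_level \<Lambda> d g \<le> a"
  shows "d \<le> Theta \<Lambda> a" "g\<^sup>2 \<le> a"
proof -
  have inj: "inj_on (Theta \<Lambda>) {0..}"
    using Theta_strict_mono by (rule strict_mono_on_imp_inj_on)
  have d: "d \<in> Theta \<Lambda> ` {0..}"
    using Theta_surj[OF assms(1)] by auto
  have "d = Theta \<Lambda> (the_inv_into {0..} (Theta \<Lambda>) d)"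
    using f_the_inv_into_f[OF inj d] by simp
  also have "\<dots> \<le> Theta \<Lambda> a"
    using the_inv_into_into[OF inj d subset_refl] assms(2)
    by (intro Theta_mono) (auto simp: noise_level_def)
  finally show "d \<le> Theta \<Lambda> a" .
  show "g\<^sup>2 \<le> a"
    using assms(2) by (simp add: noise_level_def)
qed

end

subsection \<open>The tangential cone condition\<close>

text \<open>One realization of an estimator outside the exceptional event of condition (c).\<close>

locale tangential_cone =
  fixes B :: "'x::real_normed_vector set"
    and H :: "'z::real_vector set"
    and ip :: "'z \<Rightarrow> 'z \<Rightarrow> real"
    and G :: "'x \<Rightarrow> 'z"
    and G' :: "'x \<Rightarrow> 'x \<Rightarrow> 'z"
    and \<eta> :: real
  assumes hilbert: "hilbert_on H ip"
    and G_mem: "x \<in> B \<Longrightarrow> G x \<in> H"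
    and G'_mem: "x \<in> B \<Longrightarrow> G' x h \<in> H"
    and cone: "x \<in> B \<Longrightarrow> y \<in> B \<Longrightarrow>
      hnorm ip (G x - G y - G' y (x - y)) \<le> \<eta> * hnorm ip (G x - G y)"
    and eta_nonneg: "0 \<le> \<eta>"
begin

lemma subspace_H: "subspace H"
  using hilbert by (simp add: hilbert_on_def)

lemma residual_nonneg: "x \<in> B \<Longrightarrow> y \<in> B \<Longrightarrow> 0 \<le> hnorm ip (G x - G y)"
  by (intro hnorm_nonneg[OF hilbert] subspace_diff[OF subspace_H] G_mem)

lemma residual_commute: "x \<in> B \<Longrightarrow> y \<in> B \<Longrightarrow> hnorm ip (G x - G y) = hnorm ip (G y - G x)"
  using hnorm_minus[OF hilbert, of "G x - G y"] G_mem subspace_diff[OF subspace_H] by simp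

lemma residual_triangle:
  assumes "x \<in> B" "y \<in> B" "z \<in> B"
  shows "hnorm ip (G x - G z) \<le> hnorm ip (G x - G y) + hnorm ip (G y - G z)"
  using hnorm_triangle_ineq[OF hilbert, of "G x - G y" "G y - G z"] assms G_mem
    subspace_diff[OF subspace_H] by simp

text \<open>The linearization equals \<open>G d\<close> minus the remainder \<open>?w\<close> of the
  cone condition.\<close>

lemma linearization_at_le:
  assumes "x \<in> B" "d \<in> B"
  shows "hnorm ip (G' x (d - x) + G x) \<le> \<eta> * hnorm ip (G x - G d) + hnorm ip (G d)"
proof -
  let ?w = "G d - G x - G' x (d - x)"
  have w: "?w \<in> H"
    using assms by (intro subspace_diff[OF subspace_H] G_mem G'_mem)
  have "hnorm ip (- ?w + G d) \<le> hnorm ip ?w + hnorm ip (G d)"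
    using hnorm_triangle_ineq[OF hilbert, of "- ?w" "G d"] hnorm_minus[OF hilbert w]
      subspace_neg[OF subspace_H w] G_mem[of d] assms by simp
  moreover have "hnorm ip ?w \<le> \<eta> * hnorm ip (G x - G d)"
    using cone[of d x] residual_commute[of d x] assms by simp
  ultimately show ?thesis
    by (simp add: algebra_simps)
qed

text \<open>\<open>G y - G d\<close> is split into remainder, linearization and
  \<open>- G d\<close>. The remainder is controlled by \<open>G y - G x\<close>, which is then
  measured through \<open>d\<close>.\<close>

lemma linearization_ge:
  assumes "x \<in> B" "y \<in> B" "d \<in> B"
  shows "(1 - \<eta>) * hnorm ip (G y - G d) - \<eta> * hnorm ip (G x - G d) - hnorm ip (G d)
    \<le> hnorm ip (G' x (y - x) + G x)"
proof -
  let ?w = "G y - G x - G' x (y - x)" and ?l = "G' x (y - x) + G x"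
  have mem: "?w \<in> H" "?l \<in> H" "G d \<in> H" "?w + ?l \<in> H" "- G d \<in> H"
    using assms by (auto intro!: subspace_diff[OF subspace_H] subspace_add[OF subspace_H] subspace_neg[OF subspace_H] G_mem G'_mem)
  have "hnorm ip (G y - G d) = hnorm ip (?w + ?l + - G d)"
    by (simp add: algebra_simps)
  also have "\<dots> \<le> hnorm ip ?w + hnorm ip ?l + hnorm ip (G d)"
    using hnorm_triangle_ineq[OF hilbert mem(4,5)] hnorm_triangle_ineq[OF hilbert mem(1,2)]
      hnorm_minus[OF hilbert mem(3)] by simp
  also have "hnorm ip ?w \<le> \<eta> * hnorm ip (G y - G x)"
    using cone assms by simp
  also have "\<dots> \<le> \<eta> * (hnorm ip (G y - G d) + hnorm ip (G x - G d))"
    using residual_triangle[of y d x] residual_commute[of d x] assms eta_nonneg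
    by (intro mult_left_mono) auto
  finally show ?thesis
    by (simp add: algebra_simps)
qed

lemma derivative_le:
  assumes "y \<in> B" "d \<in> B"
  shows "hnorm ip (G' d (y - d)) \<le> (1 + \<eta>) * hnorm ip (G y - G d)"
proof -
  let ?w = "G y - G d - G' d (y - d)"
  have mem: "?w \<in> H" "G y - G d \<in> H" "- ?w \<in> H"
    using assms by (auto intro!: subspace_diff[OF subspace_H] G_mem G'_mem)
  have "hnorm ip (- ?w + (G y - G d)) \<le> hnorm ip ?w + hnorm ip (G y - G d)"
    using hnorm_triangle_ineq[OF hilbert mem(3,2)] hnorm_minus[OF hilbert mem(1)] by simp
  moreover have "hnorm ip ?w \<le> \<eta> * hnorm ip (G y - G d)"
    using cone assms by simp
  ultimately show ?thesis
    by (simp add: algebra_simps)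
qed

end

subsection \<open>The Gauss-Newton recursion\<close>

text \<open>In the next two lemmas \<^term>\<open>u\<close> and \<^term>\<open>v\<close> are the new and the old residual, \<^term>\<open>s\<^sup>2\<close> is the
  Bregman distance weighted by the regularization parameter \<^term>\<open>a\<close>, and \<^term>\<open>T\<close> is \<^term>\<open>Theta \<Lambda> a\<close>.\<close>

lemma residual_recursion:
  fixes lin u v s T M b p \<epsilon> \<eta> :: real
  assumes "0 \<le> lin" "0 \<le> u" "0 \<le> v" "0 \<le> T" "0 \<le> M" "0 \<le> b" "0 \<le> p" "0 < \<epsilon>" "0 \<le> \<eta>"
    and lower: "(1 - \<eta>) * u - \<eta> * v - M * T \<le> lin"
    and energy: "lin\<^sup>2 + s\<^sup>2 \<le> (\<eta> * v + M * T)\<^sup>2 + b * T * ((1 + M) * s + p * u)"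
  shows "(1 - \<eta> - \<epsilon>) * u \<le> 2 * \<eta> * v + (2 * M + b * (1 + M) + b * p / (2 * \<epsilon>)) * T"
proof -
  \<comment> \<open>Chosen so that \<open>2 * c * (\<epsilon> * u)\<close> is the term
    \<open>b * T * p * u\<close>; Young's inequality then leaves only \<open>\<epsilon> * u\<close>
    to be absorbed on the left.\<close>
  define c where "c = b * p / (2 * \<epsilon>) * T"
  define e where "e = b * (1 + M) * T"
  have ce: "0 \<le> c" "0 \<le> e"
    using assms by (auto simp: c_def e_def)
  have "lin\<^sup>2 + s\<^sup>2 \<le> (\<eta> * v + M * T)\<^sup>2 + e * s + 2 * c * (\<epsilon> * u)"
    using energy assms by (simp add: c_def e_def algebra_simps)
  \<comment> \<open>The \<open>s\<^sup>2\<close> produced here cancels the one in the energy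
    estimate.\<close>
  moreover have "e * s \<le> s\<^sup>2 + e\<^sup>2"
    using sum_squares_bound[of e s] zero_le_power2[of e] zero_le_power2[of s] by linarith
  moreover have "2 * c * (\<epsilon> * u) \<le> (c + \<epsilon> * u)\<^sup>2"
    by (simp add: power2_sum)
  ultimately have "lin\<^sup>2 \<le> (\<eta> * v + M * T)\<^sup>2 + e\<^sup>2 + (c + \<epsilon> * u)\<^sup>2"
    by linarith
  also have "\<dots> \<le> ((\<eta> * v + M * T) + e + (c + \<epsilon> * u))\<^sup>2"
  proof -
    have "(x::real)\<^sup>2 + y\<^sup>2 + z\<^sup>2 \<le> (x + y + z)\<^sup>2" if "0 \<le> x" "0 \<le> y" "0 \<le> z" for x y z
      using that mult_nonneg_nonneg[of x y] mult_nonneg_nonneg[of x z] mult_nonneg_nonneg[of y z]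
      by (simp add: power2_eq_square algebra_simps)
    then show ?thesis
      using assms ce by simp
  qed
  finally have "lin \<le> (\<eta> * v + M * T) + e + (c + \<epsilon> * u)"
    by (rule power2_le_imp_le) (use assms ce in simp)
  with lower show ?thesis
    by (simp add: c_def e_def algebra_simps)
qed

lemma energy_bound:
  fixes lin u v s T M b p U V \<eta> :: real
  assumes "0 \<le> v" "0 \<le> T" "0 \<le> M" "0 \<le> b" "0 \<le> p" "0 \<le> \<eta>" "u \<le> U * T" "v \<le> V * T"
    and energy: "lin\<^sup>2 + s\<^sup>2 \<le> (\<eta> * v + M * T)\<^sup>2 + b * T * ((1 + M) * s + p * u)"
  shows "s\<^sup>2 \<le> (2 * (\<eta> * V + M)\<^sup>2 + 2 * b * p * U + (b * (1 + M))\<^sup>2) * T\<^sup>2"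
proof -
  define e where "e = b * (1 + M) * T"
  have "\<eta> * v + M * T \<le> (\<eta> * V + M) * T"
    using mult_left_mono[of v "V * T" \<eta>] assms by (simp add: algebra_simps)
  then have 1: "(\<eta> * v + M * T)\<^sup>2 \<le> ((\<eta> * V + M) * T)\<^sup>2"
    using assms by (intro power_mono) auto
  have "b * T * (p * u) \<le> b * T * (p * (U * T))"
    using assms by (intro mult_left_mono) auto
  moreover have "b * T * ((1 + M) * s + p * u) = e * s + b * T * (p * u)"
    "b * T * (p * (U * T)) = b * p * U * T\<^sup>2"
    by (simp_all add: e_def algebra_simps power2_eq_square)
  ultimately have "s\<^sup>2 \<le> ((\<eta> * V + M) * T)\<^sup>2 + e * s + b * p * U * T\<^sup>2"
    using energy 1 zero_le_power2[of lin] by linarith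
  \<comment> \<open>After doubling the previous estimate, one of the two copies of
    \<open>s\<^sup>2\<close> survives on the left.\<close>
  moreover have "2 * (e * s) \<le> s\<^sup>2 + e\<^sup>2"
    using sum_squares_bound[of e s] by simp
  ultimately have "s\<^sup>2 \<le> 2 * ((\<eta> * V + M) * T)\<^sup>2 + e\<^sup>2 + 2 * (b * p * U * T\<^sup>2)"
    by linarith
  then show ?thesis
    unfolding e_def power_mult_distrib by (simp add: distrib_right distrib_left mult_ac)
qed

section \<open>Finiteness and sign of the Bregman distance\<close>

text \<open>The subgradient inequality tested at a point with finite penalty excludes the value
  \<open>\<infinity>\<close> at \<open>d\<close>.\<close>

lemma subgradient_imp_finite:
  assumes "\<And>x. x \<in> B \<Longrightarrow> R x \<noteq> -\<infinity>" "\<exists>x\<in>B. R x \<noteq> \<infinity>" "\<xi> \<in> subdifferential B R d" "d \<in> B"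
  shows "\<exists>r. R d = ereal r"
proof -
  obtain x where x: "x \<in> B" "R x \<noteq> \<infinity>"
    using assms(2) by blast
  have "R d + ereal (blinfun_apply \<xi> (x - d)) \<le> R x"
    using assms x by (simp add: subdifferential_def)
  then have "R d \<noteq> \<infinity>"
    using x by auto
  then show ?thesis
    using assms(1)[OF assms(4)] by (cases "R d") auto
qed

lemma bregman_nonneg:
  assumes "\<And>x. x \<in> B \<Longrightarrow> R x \<noteq> -\<infinity>" "\<exists>x\<in>B. R x \<noteq> \<infinity>" "\<xi> \<in> subdifferential B R d" "d \<in> B" "y \<in> B"
  shows "0 \<le> bregman R \<xi> y d"
proof -
  obtain r where r: "R d = ereal r"
    using subgradient_imp_finite[OF assms(1-4)] by blast
  have "R d + ereal (blinfun_apply \<xi> (y - d)) \<le> R y"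
    using assms by (simp add: subdifferential_def)
  then show ?thesis
    using r by (cases "R y") (auto simp: bregman_def)
qed

lemma bregman_real:
  assumes "\<And>x. x \<in> B \<Longrightarrow> R x \<noteq> -\<infinity>" "\<exists>x\<in>B. R x \<noteq> \<infinity>" "\<xi> \<in> subdifferential B R d" "d \<in> B"
    "y \<in> B" "R y \<noteq> \<infinity>"
  shows "bregman R \<xi> y d = ereal (real_of_ereal (bregman R \<xi> y d))"
  using subgradient_imp_finite[OF assms(1-4)] assms(1)[OF assms(5)] assms(6)
  by (cases "R y") (auto simp: bregman_def)

section \<open>Deterministic error analysis for one realization\<close>

text \<open>\<open>A\<close> plays the exact derivative at the root \<open>d\<close>,
  \<open>G\<close> the estimated operator, and \<open>M\<close> is a common constant for both
  stochastic errors. Points with infinite penalty are excluded because \<open>real_of_ereal\<close>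
  would turn their distance into 0.\<close>

locale gauss_newton = tangential_cone B H ip G G' \<eta> + source_function \<Lambda>
  for B :: "'x::real_normed_vector set"
    and H :: "'z::real_vector set" and ip G G' \<eta> \<Lambda> +
  fixes R :: "'x \<Rightarrow> ereal"
    and \<xi> :: "'x \<Rightarrow>\<^sub>L real"
    and A :: "'x \<Rightarrow> 'y::real_normed_vector"
    and d :: 'x
    and b M \<delta> \<gamma> :: real
  assumes d_mem: "d \<in> B"
    and proper: "x \<in> B \<Longrightarrow> R x \<noteq> -\<infinity>" "\<exists>x\<in>B. R x \<noteq> \<infinity>"
    and subgradient: "\<xi> \<in> subdifferential B R d"
    and constants: "0 \<le> b" "0 \<le> M"
    and source: "y \<in> B \<Longrightarrow> R y \<noteq> \<infinity> \<Longrightarrow>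
      blinfun_apply \<xi> (d - y) \<le> b * sqrt (real_of_ereal (bregman R \<xi> y d))
        * \<Lambda> ((norm (A (y - d)))\<^sup>2 / real_of_ereal (bregman R \<xi> y d))"
    and noise: "hnorm ip (G d) \<le> M * \<delta>"
    and derivative_error: "y \<in> B \<Longrightarrow> R y \<noteq> \<infinity> \<Longrightarrow> bregman R \<xi> y d \<noteq> 0 \<Longrightarrow>
      (norm (A (y - d)))\<^sup>2
        \<le> (hnorm ip (G' d (y - d)))\<^sup>2 + (M * \<gamma>)\<^sup>2 * real_of_ereal (bregman R \<xi> y d)"
begin

definition \<Delta> :: "'x \<Rightarrow> real" where
  "\<Delta> y = real_of_ereal (bregman R \<xi> y d)"

lemma bregman_finite:
  assumes "y \<in> B" "R y \<noteq> \<infinity>"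
  shows "bregman R \<xi> y d = ereal (\<Delta> y)" "0 \<le> \<Delta> y"
    "R y = R d + ereal (\<Delta> y - blinfun_apply \<xi> (d - y))"
proof -
  show "bregman R \<xi> y d = ereal (\<Delta> y)"
    unfolding \<Delta>_def using bregman_real[OF proper subgradient d_mem assms] .
  show "0 \<le> \<Delta> y"
    unfolding \<Delta>_def using bregman_nonneg[OF proper subgradient d_mem assms(1)]
    by (rule real_of_ereal_pos)
  obtain r where "R d = ereal r"
    using subgradient_imp_finite[OF proper subgradient d_mem] by blast
  then show "R y = R d + ereal (\<Delta> y - blinfun_apply \<xi> (d - y))"
    using assms proper(1)[of y] by (cases "R y") (auto simp: \<Delta>_def bregman_def blinfun.diff_right)
qed

text \<open>The derivative error and the cone condition bound \<open>norm (A (y - d))\<close> by the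
  residual plus a multiple of \<open>sqrt (a * \<Delta> y)\<close>. The affine bound on
  \<open>\<Lambda>\<close> around \<open>a\<close> carries this over to the source term.\<close>

lemma source_term_le:
  assumes y: "y \<in> B" "R y \<noteq> \<infinity>" and a: "0 < a" "\<gamma>\<^sup>2 \<le> a"
  shows "a * blinfun_apply \<xi> (d - y) \<le>
    b * Theta \<Lambda> a * ((1 + M) * sqrt (a * \<Delta> y) + (1 + \<eta>) * hnorm ip (G y - G d))"
    (is "_ \<le> b * _ * (_ + (1 + \<eta>) * ?u)")
proof -
  let ?t = "(norm (A (y - d)))\<^sup>2 / \<Delta> y"
  have u: "0 \<le> ?u"
    using residual_nonneg y d_mem by blast
  have \<Delta>: "0 \<le> \<Delta> y"
    using bregman_finite y by blast
  have key: "sqrt (\<Delta> y) * \<Lambda> ?t \<le> \<Lambda> a * ((1 + M) * sqrt (\<Delta> y) + (1 + \<eta>) * ?u / sqrt a)"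
  proof (cases "\<Delta> y = 0")
    case True
    \<comment> \<open>The left-hand side is 0, so the case left out by
      \<open>derivative_error\<close> is harmless.\<close>
    then show ?thesis
      using nonneg[of a] a u eta_nonneg by simp
  next
    case False
    then have pos: "0 < \<Delta> y"
      using \<Delta> by simp
    have "?t * \<Delta> y = (norm (A (y - d)))\<^sup>2"
      using pos by simp
    also have "\<dots> \<le> (hnorm ip (G' d (y - d)))\<^sup>2 + (M * \<gamma>)\<^sup>2 * \<Delta> y"
      using derivative_error[OF y] bregman_finite(1)[OF y] False by simp
    also have "\<dots> \<le> ((1 + \<eta>) * ?u)\<^sup>2 + M\<^sup>2 * a * \<Delta> y"
      using a pos y d_mem derivative_le[of y d] hnorm_nonneg[OF hilbert G'_mem[OF d_mem]]
      by (intro add_mono power_mono mult_right_mono)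
        (auto simp: power_mult_distrib intro!: mult_left_mono)
    also have "\<dots> \<le> ((1 + \<eta>) * ?u + M * sqrt (a * \<Delta> y))\<^sup>2"
      using a pos u eta_nonneg constants by (simp add: power2_sum power_mult_distrib)
    finally have "sqrt (?t * \<Delta> y) \<le> (1 + \<eta>) * ?u + M * sqrt (a * \<Delta> y)"
      using a pos u eta_nonneg constants by (intro real_le_lsqrt) auto
    then have "sqrt (?t * \<Delta> y) / sqrt a \<le> ((1 + \<eta>) * ?u + M * sqrt (a * \<Delta> y)) / sqrt a"
      using a by (intro divide_right_mono) auto
    then have *: "sqrt (\<Delta> y) * sqrt (?t / a) \<le> (1 + \<eta>) * ?u / sqrt a + M * sqrt (\<Delta> y)"
      using a pos by (simp add: real_sqrt_mult real_sqrt_divide add_divide_distrib)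
    have "sqrt (\<Delta> y) * \<Lambda> ?t \<le> sqrt (\<Delta> y) * ((1 + sqrt (?t / a)) * \<Lambda> a)"
      using le_one_plus_sqrt_ratio[of a ?t] a pos by (intro mult_left_mono) auto
    also have "\<dots> = \<Lambda> a * (sqrt (\<Delta> y) + sqrt (\<Delta> y) * sqrt (?t / a))"
      by (simp add: algebra_simps)
    also have "\<dots> \<le> \<Lambda> a * (sqrt (\<Delta> y) + ((1 + \<eta>) * ?u / sqrt a + M * sqrt (\<Delta> y)))"
      using * a nonneg[of a] by (intro mult_left_mono add_left_mono) auto
    finally show ?thesis
      by (simp add: algebra_simps)
  qed
  have "a * blinfun_apply \<xi> (d - y) \<le> a * (b * (sqrt (\<Delta> y) * \<Lambda> ?t))"
    using source[OF y] a by (simp add: \<Delta>_def mult.assoc)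
  also have "\<dots> \<le> a * (b * (\<Lambda> a * ((1 + M) * sqrt (\<Delta> y) + (1 + \<eta>) * ?u / sqrt a)))"
    using key a constants by (intro mult_left_mono) auto
  \<comment> \<open>One root completes \<open>\<Lambda> a\<close> to
    \<open>Theta \<Lambda> a\<close>, the other weights the bracket.\<close>
  also have "\<dots> = b * \<Lambda> a * (sqrt a * sqrt a) * ((1 + M) * sqrt (\<Delta> y) + (1 + \<eta>) * ?u / sqrt a)"
    using a by simp
  also have "\<dots> = b * Theta \<Lambda> a * (sqrt a * ((1 + M) * sqrt (\<Delta> y) + (1 + \<eta>) * ?u / sqrt a))"
    by (simp only: Theta_def mult_ac)
  also have "sqrt a * ((1 + M) * sqrt (\<Delta> y) + (1 + \<eta>) * ?u / sqrt a)
      = (1 + M) * sqrt (a * \<Delta> y) + (1 + \<eta>) * ?u"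
    using a by (simp add: real_sqrt_mult distrib_left)
  finally show ?thesis .
qed

lemma step:
  assumes x: "x \<in> B" and a: "0 < a" "\<delta> \<le> Theta \<Lambda> a" "\<gamma>\<^sup>2 \<le> a"
    and min: "is_arg_min (gn_functional R (hnorm ip) G G' a x) (\<lambda>z. z \<in> B) y"
  shows "y \<in> B" "R y \<noteq> \<infinity>"
    and "(hnorm ip (G' x (y - x) + G x))\<^sup>2 + (sqrt (a * \<Delta> y))\<^sup>2
      \<le> (\<eta> * hnorm ip (G x - G d) + M * Theta \<Lambda> a)\<^sup>2
        + b * Theta \<Lambda> a * ((1 + M) * sqrt (a * \<Delta> y) + (1 + \<eta>) * hnorm ip (G y - G d))"
proof -
  let ?l = "\<lambda>z. hnorm ip (G' x (z - x) + G x)"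
  obtain r where r: "R d = ereal r"
    using subgradient_imp_finite[OF proper subgradient d_mem] by blast
  show y: "y \<in> B"
    using min by (simp add: is_arg_min_def)
  have le: "ereal ((?l y)\<^sup>2) + ereal a * R y \<le> ereal ((?l d)\<^sup>2) + ereal a * ereal r"
    using min d_mem r by (force simp: is_arg_min_def gn_functional_def not_less)
  show fin: "R y \<noteq> \<infinity>"
    using le a by auto
  \<comment> \<open>Expressing \<open>R y\<close> through \<open>\<Delta> y\<close> makes
    \<open>R d\<close> cancel and produces the source term.\<close>
  have "(?l y)\<^sup>2 + a * \<Delta> y \<le> (?l d)\<^sup>2 + a * blinfun_apply \<xi> (d - y)"
    using le bregman_finite(3)[OF y fin] r by (simp add: algebra_simps)
  also have "(?l d)\<^sup>2 \<le> (\<eta> * hnorm ip (G x - G d) + M * Theta \<Lambda> a)\<^sup>2"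
  proof (rule power_mono)
    have "M * \<delta> \<le> M * Theta \<Lambda> a"
      using a constants by (intro mult_left_mono)
    then show "?l d \<le> \<eta> * hnorm ip (G x - G d) + M * Theta \<Lambda> a"
      using linearization_at_le[OF x d_mem] noise by simp
    show "0 \<le> ?l d"
      using x by (intro hnorm_nonneg[OF hilbert] subspace_add[OF subspace_H] G_mem G'_mem)
  qed
  also note source_term_le[OF y fin a(1,3)]
  finally show "(?l y)\<^sup>2 + (sqrt (a * \<Delta> y))\<^sup>2
      \<le> (\<eta> * hnorm ip (G x - G d) + M * Theta \<Lambda> a)\<^sup>2
        + b * Theta \<Lambda> a * ((1 + M) * sqrt (a * \<Delta> y) + (1 + \<eta>) * hnorm ip (G y - G d))"
    using a bregman_finite(2)[OF y fin] by simp
qed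

text \<open>\<open>E\<close> is large enough that the constant part of the recursion is at most
  \<open>E * \<epsilon>\<close>, so the bound reproduces itself under one step. The distance
  estimate requires \<open>0 < k\<close>, as the initial guess minimizes no functional.\<close>

lemma iteration:
  fixes \<phi> :: "nat \<Rightarrow> 'x" and \<alpha> :: "nat \<Rightarrow> real"
  assumes start: "\<phi> 0 \<in> B" "hnorm ip (G (\<phi> 0) - G d) \<le> E * Theta \<Lambda> (\<alpha> 0)"
    and min: "\<And>k. is_arg_min (gn_functional R (hnorm ip) G G' (\<alpha> (Suc k)) (\<phi> k))
      (\<lambda>z. z \<in> B) (\<phi> (Suc k))"
    and alpha: "\<And>k. 0 < \<alpha> k" "\<And>k. \<alpha> k \<le> q * \<alpha> (Suc k)"
    and level: "\<And>k. k \<le> K \<Longrightarrow> \<delta> \<le> Theta \<Lambda> (\<alpha> k)" "\<And>k. k \<le> K \<Longrightarrow> \<gamma>\<^sup>2 \<le> \<alpha> k"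
    and q: "1 \<le> q"
    and eps: "0 < \<epsilon>" "2 * \<eta> * q + 2 * \<epsilon> \<le> 1 - \<eta>"
    and E: "(2 * M + b * (1 + M) + b * (1 + \<eta>) / (2 * \<epsilon>)) / \<epsilon> \<le> E"
  shows "k \<le> K \<Longrightarrow> \<phi> k \<in> B \<and> hnorm ip (G (\<phi> k) - G d) \<le> E * Theta \<Lambda> (\<alpha> k)"
    and "0 < k \<Longrightarrow> k \<le> K \<Longrightarrow> R (\<phi> k) \<noteq> \<infinity> \<and>
      \<Delta> (\<phi> k) \<le> (2 * (\<eta> * (q * E) + M)\<^sup>2 + 2 * b * (1 + \<eta>) * E + (b * (1 + M))\<^sup>2) * (\<Lambda> (\<alpha> k))\<^sup>2"
proof -
  define e where "e k = hnorm ip (G (\<phi> k) - G d)" for k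
  define c where "c = 2 * M + b * (1 + M) + b * (1 + \<eta>) / (2 * \<epsilon>)"
  have "0 \<le> c"
    unfolding c_def using constants eta_nonneg eps by auto
  moreover have "c / \<epsilon> \<le> E"
    using E by (simp only: c_def)
  ultimately have E0: "0 \<le> E" and cE: "c \<le> E * \<epsilon>"
    using eps divide_nonneg_pos[of c \<epsilon>] by (linarith, simp add: pos_divide_le_eq)
  have prev: "e k \<le> q * E * Theta \<Lambda> (\<alpha> (Suc k))" if "e k \<le> E * Theta \<Lambda> (\<alpha> k)" for k
  proof -
    have "Theta \<Lambda> (\<alpha> k) \<le> Theta \<Lambda> (q * \<alpha> (Suc k))"
      using alpha[of k] by (intro Theta_mono) auto
    also have "\<dots> \<le> q * Theta \<Lambda> (\<alpha> (Suc k))"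
      using alpha q by (intro Theta_le_mult)
    finally have "E * Theta \<Lambda> (\<alpha> k) \<le> E * (q * Theta \<Lambda> (\<alpha> (Suc k)))"
      using E0 by (intro mult_left_mono)
    with that show ?thesis by (simp add: mult_ac)
  qed
  note step = step[OF _ alpha(1) level min]
  have main: "\<phi> k \<in> B \<and> e k \<le> E * Theta \<Lambda> (\<alpha> k)" if "k \<le> K" for k
    using that
  proof (induction k)
    case 0
    then show ?case using start by (simp add: e_def)
  next
    case (Suc k)
    then have k: "\<phi> k \<in> B" "e k \<le> E * Theta \<Lambda> (\<alpha> k)" "k \<le> K"
      by auto
    let ?T = "Theta \<Lambda> (\<alpha> (Suc k))"
    have T: "0 < ?T"
      using Theta_pos alpha by blast
    note s = step[OF k(1) Suc.prems Suc.prems]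
    have en: "0 \<le> e (Suc k)" "0 \<le> e k"
      using residual_nonneg k s d_mem by (auto simp: e_def)
    have "M * \<delta> \<le> M * ?T"
      using level Suc.prems constants by (intro mult_left_mono) auto
    then have "(1 - \<eta>) * e (Suc k) - \<eta> * e k - M * ?T
        \<le> hnorm ip (G' (\<phi> k) (\<phi> (Suc k) - \<phi> k) + G (\<phi> k))"
      using linearization_ge[OF k(1) s(1) d_mem] noise by (simp add: e_def)
    moreover have "0 \<le> hnorm ip (G' (\<phi> k) (\<phi> (Suc k) - \<phi> k) + G (\<phi> k))"
      using k by (intro hnorm_nonneg[OF hilbert] subspace_add[OF subspace_H] G_mem G'_mem)
    ultimately have "(1 - \<eta> - \<epsilon>) * e (Suc k) \<le> 2 * \<eta> * e k + c * ?T"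
      using s(3) T en constants eta_nonneg eps unfolding c_def
      by (intro residual_recursion) (auto simp: e_def)
    also have "\<dots> \<le> 2 * \<eta> * (q * E * ?T) + E * \<epsilon> * ?T"
      using prev[OF k(2)] cE T eta_nonneg by (intro add_mono mult_left_mono mult_right_mono) auto
    also have "\<dots> = (2 * \<eta> * q + \<epsilon>) * (E * ?T)"
      by (simp add: algebra_simps)
    \<comment> \<open>One \<open>\<epsilon>\<close> pays for the constant term, the other for the
      absorbed part of the new residual.\<close>
    also have "\<dots> \<le> (1 - \<eta> - \<epsilon>) * (E * ?T)"
      using eps E0 T by (intro mult_right_mono) auto
    finally have "(1 - \<eta> - \<epsilon>) * e (Suc k) \<le> (1 - \<eta> - \<epsilon>) * (E * ?T)" .
    \<comment> \<open>With \<open>eps\<close> this makes the common factor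
      \<open>1 - \<eta> - \<epsilon>\<close> positive, so it can be cancelled.\<close>
    moreover have "0 \<le> \<eta> * q"
      using eta_nonneg q by simp
    ultimately have "e (Suc k) \<le> E * ?T"
      using eps by (subst (asm) mult_le_cancel_left_pos) linarith+
    with s(1) show ?case by simp
  qed
  then show "k \<le> K \<Longrightarrow> \<phi> k \<in> B \<and> hnorm ip (G (\<phi> k) - G d) \<le> E * Theta \<Lambda> (\<alpha> k)"
    by (simp add: e_def)
  assume k: "0 < k" "k \<le> K"
  then obtain j where j: "k = Suc j"
    by (cases k) auto
  let ?T = "Theta \<Lambda> (\<alpha> k)"
  let ?C = "2 * (\<eta> * (q * E) + M)\<^sup>2 + 2 * b * (1 + \<eta>) * E + (b * (1 + M))\<^sup>2"
  have jB: "\<phi> j \<in> B" "e j \<le> E * Theta \<Lambda> (\<alpha> j)"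
    using main[of j] k j by auto
  note s = step[OF jB(1) k(2)[unfolded j] k(2)[unfolded j], folded j]
  have "(sqrt (\<alpha> k * \<Delta> (\<phi> k)))\<^sup>2 \<le> ?C * ?T\<^sup>2"
    using s(3) prev[OF jB(2)] main[OF k(2)] constants eta_nonneg
      residual_nonneg[OF jB(1) d_mem] Theta_pos[OF alpha(1), of k]
    by (intro energy_bound[where u = "e k" and v = "e j"]) (auto simp: e_def j)
  then have "\<alpha> k * \<Delta> (\<phi> k) \<le> \<alpha> k * (?C * (\<Lambda> (\<alpha> k))\<^sup>2)"
    using bregman_finite(2)[OF s(1,2)] alpha(1)[of k] by (simp add: Theta_def power_mult_distrib mult_ac)
  then show "R (\<phi> k) \<noteq> \<infinity> \<and> \<Delta> (\<phi> k) \<le> ?C * (\<Lambda> (\<alpha> k))\<^sup>2"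
    using alpha(1)[of k] s(2) by simp
qed

end

subsection \<open>Convergence rate\<close>

text \<open>Finiteness of the first supremum is essential: \<^const>\<open>real_of_ereal\<close> sends an infinite supremum
  to \<^term>\<open>0\<close>, so the bound \<^term>\<open>c\<close> alone would be void.\<close>

lemma le_of_sup_quotient_diff:
  fixes D :: "'x \<Rightarrow> ereal" and f g :: "'x \<Rightarrow> real"
  assumes fin: "(SUP y\<in>S. ereal (f y) / D y) < \<infinity>"
    and D: "\<And>y. y \<in> S \<Longrightarrow> 0 < D y" and g: "\<And>y. 0 \<le> g y"
    and le: "sqrt (real_of_ereal \<bar>SUP y\<in>S. ereal (f y - g y) / D y\<bar>) \<le> c"
    and y: "y \<in> S" "D y = ereal t"
  shows "f y \<le> g y + c\<^sup>2 * t"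
proof -
  have t: "0 < t"
    using D y by force
  let ?S = "SUP y\<in>S. ereal (f y - g y) / D y"
  \<comment> \<open>This excludes \<open>\<infinity>\<close>; the quotient at the given
    \<open>y\<close> excludes \<open>-\<infinity>\<close>, so \<open>real_of_ereal\<close> loses
    nothing.\<close>
  have "?S \<le> (SUP y\<in>S. ereal (f y) / D y)"
    using g D by (intro SUP_mono) (auto intro!: bexI ereal_divide_right_mono)
  then have "?S < \<infinity>"
    using fin by (rule le_less_trans)
  moreover have "ereal ((f y - g y) / t) \<le> ?S"
    using SUP_upper[of y S "\<lambda>y. ereal (f y - g y) / D y"] y t by simp
  ultimately obtain s where s: "?S = ereal s" "(f y - g y) / t \<le> s"
    by (cases ?S) auto
  have "sqrt \<bar>s\<bar> \<le> c"
    using le s by simp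
  then have "\<bar>s\<bar> \<le> c\<^sup>2"
    by (rule sqrt_le_D)
  with s t have "f y - g y \<le> c\<^sup>2 * t"
    by (simp add: pos_divide_le_eq mult_right_mono[of s "c\<^sup>2" t] order_trans[OF _ mult_right_mono])
  then show ?thesis by simp
qed

text \<open>Brings the smallness condition into the form the induction uses, by
  \<open>(1 - \<eta>) ^ 3 \<le> 1 - \<eta>\<close>, \<open>1 \<le> 2 * (1 + \<eta>)\<close> and
  \<open>q powr (- 3 / 2) \<le> q powr (- 1)\<close>.\<close>

lemma contraction_condition:
  fixes \<eta> q :: real
  assumes "1 < q" "0 \<le> \<eta>" "\<eta> < 1" "4 * \<eta> * (1 + \<eta>) / (1 - \<eta>) ^ 3 < q powr (- 3 / 2)"
  shows "2 * \<eta> * q < 1 - \<eta>"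
proof -
  have cube: "0 < (1 - \<eta>) ^ 3" "(1 - \<eta>) ^ 3 \<le> 1 - \<eta>"
    using assms power_decreasing[of 1 3 "1 - \<eta>"] by auto
  have "2 * \<eta> / (1 - \<eta>) \<le> 2 * \<eta> / (1 - \<eta>) ^ 3"
    using cube assms by (intro divide_left_mono mult_pos_pos) auto
  also have "\<dots> \<le> 4 * \<eta> * (1 + \<eta>) / (1 - \<eta>) ^ 3"
    using cube assms by (intro divide_right_mono) (auto simp: algebra_simps)
  also have "\<dots> < q powr (- 3 / 2)"
    by fact
  also have "\<dots> \<le> q powr (- 1)"
    using assms by (intro powr_mono) auto
  also have "\<dots> = 1 / q"
    using assms by (simp add: powr_minus_divide)
  finally show ?thesis
    using assms by (simp add: field_simps)
qed

text \<open>\<open>approx_initial\<close> starts the induction with a constant independent of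
  \<open>n\<close>; \<open>initial_dom\<close> keeps the distance finite when the initial guess
  itself is returned. \<open>\<eta> < 1\<close> is explicit because for larger values the quotient
  in \<open>eta\<close> is negative, or 0 at \<open>\<eta> = 1\<close>. The source condition is
  restricted to finite penalty, where \<open>real_of_ereal\<close> is faithful.\<close>

theorem theorem1:
  fixes P :: "'w measure"
    and B :: "'x::banach set"
    and R :: "'x \<Rightarrow> ereal"
    and sg :: "'x \<Rightarrow> ('x \<Rightarrow>\<^sub>L real)"
    and F :: "'x \<Rightarrow> 'y::{real_inner, complete_space}"
    and F' :: "'x \<Rightarrow> 'x \<Rightarrow> 'y"
    and \<phi>d \<phi>0 :: 'x
    and H :: "nat \<Rightarrow> 'w \<Rightarrow> 'z::real_vector set"
    and ip :: "nat \<Rightarrow> 'w \<Rightarrow> 'z \<Rightarrow> 'z \<Rightarrow> real"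
    and Fh :: "nat \<Rightarrow> 'w \<Rightarrow> 'x \<Rightarrow> 'z"
    and Fh' :: "nat \<Rightarrow> 'w \<Rightarrow> 'x \<Rightarrow> 'x \<Rightarrow> 'z"
    and \<Lambda> :: "real \<Rightarrow> real"
    and \<alpha> \<delta> \<gamma> :: "nat \<Rightarrow> real"
    and K :: "nat \<Rightarrow> nat"
    and \<beta> \<eta> q :: real
  assumes prob: "prob_space P"
    and B: "convex B" "\<phi>d \<in> B" "\<phi>0 \<in> B"
    and root: "F \<phi>d = 0"
    and penalty: "proper_convex_lsc B R"
    and subgrad_dagger: "sg \<phi>d \<in> subdifferential B R \<phi>d"
    and subgrad: "\<And>\<phi>. \<phi> \<in> B \<Longrightarrow> subdifferential B R \<phi> \<noteq> {} \<Longrightarrow> sg \<phi> \<in> subdifferential B R \<phi>"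
    and F_gateaux: "gateaux_on B norm F F'"
    and F_bounded: "bregman_bounded_on B R sg norm F'"
    and hilbert: "\<And>n \<omega>. \<omega> \<in> space P \<Longrightarrow> hilbert_on (H n \<omega>) (ip n \<omega>)"
    and Fh_range: "\<And>n \<omega> \<phi>. \<omega> \<in> space P \<Longrightarrow> \<phi> \<in> B \<Longrightarrow> Fh n \<omega> \<phi> \<in> H n \<omega>"
    and Fh'_range: "\<And>n \<omega> \<phi> h. \<omega> \<in> space P \<Longrightarrow> \<phi> \<in> B \<Longrightarrow> Fh' n \<omega> \<phi> h \<in> H n \<omega>"
    and Fh_gateaux: "\<And>n \<omega>. \<omega> \<in> space P \<Longrightarrow>
          gateaux_on B (hnorm (ip n \<omega>)) (Fh n \<omega>) (Fh' n \<omega>)"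
    and Fh_bounded: "\<And>n \<omega>. \<omega> \<in> space P \<Longrightarrow>
          bregman_bounded_on B R sg (hnorm (ip n \<omega>)) (Fh' n \<omega>)"
    and Lambda: "\<Lambda> ` {0..} \<subseteq> {0..}" "continuous_on {0..} \<Lambda>" "strict_mono_on {0..} \<Lambda>" "\<Lambda> 0 = 0"
    and Lambda_concave: "concave_on {0..} \<Lambda>"
    and Lambda_mono: "mono_on {0<..} (\<lambda>t. sqrt t / \<Lambda> t)"
    and source_condition: "\<And>\<phi>. \<phi> \<in> B \<Longrightarrow> R \<phi> \<noteq> \<infinity> \<Longrightarrow>
          blinfun_apply (sg \<phi>d) (\<phi>d - \<phi>)
            \<le> \<beta> * sqrt (real_of_ereal (bregman R (sg \<phi>d) \<phi> \<phi>d))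
                * \<Lambda> ((norm (F' \<phi>d (\<phi> - \<phi>d)))\<^sup>2 / real_of_ereal (bregman R (sg \<phi>d) \<phi> \<phi>d))"
    and alpha: "\<And>k. 0 < \<alpha> k" "\<alpha> \<longlonglongrightarrow> 0"
    and rates: "\<And>n. 0 \<le> \<delta> n" "\<And>n. 0 \<le> \<gamma> n"
    and conv_a: "stoch_bounded P (\<lambda>n \<omega>. ereal (hnorm (ip n \<omega>) (Fh n \<omega> \<phi>d))) \<delta>"
    and conv_b: "stoch_bounded P
          (\<lambda>n \<omega>. ereal (sqrt (real_of_ereal
             \<bar>SUP \<phi>\<in>{\<phi>\<in>B. bregman R (sg \<phi>d) \<phi> \<phi>d \<noteq> 0}.
                ereal ((norm (F' \<phi>d (\<phi> - \<phi>d)))\<^sup>2 - (hnorm (ip n \<omega>) (Fh' n \<omega> \<phi>d (\<phi> - \<phi>d)))\<^sup>2)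
                  / bregman R (sg \<phi>d) \<phi> \<phi>d\<bar>))) \<gamma>"
    and conv_c: "(\<lambda>n. outer_measure_of P {\<omega> \<in> space P. \<exists>\<phi>1\<in>B. \<exists>\<phi>2\<in>B.
            \<eta> * hnorm (ip n \<omega>) (Fh n \<omega> \<phi>1 - Fh n \<omega> \<phi>2)
              < hnorm (ip n \<omega>) (Fh n \<omega> \<phi>1 - Fh n \<omega> \<phi>2 - Fh' n \<omega> \<phi>2 (\<phi>1 - \<phi>2))}) \<longlonglongrightarrow> 0"
    and approx_initial: "stoch_bounded P (\<lambda>n \<omega>. ereal (hnorm (ip n \<omega>) (Fh n \<omega> \<phi>0))) (\<lambda>_. 1)"
    and q: "1 < q"
    and eta: "0 \<le> \<eta>" "\<eta> < 1" "4 * \<eta> * (1 + \<eta>) / (1 - \<eta>) ^ 3 < q powr (- 3 / 2)"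
    and well_defined: "\<And>n \<omega> k. \<omega> \<in> space P \<Longrightarrow>
          \<exists>!\<psi>. is_arg_min
            (gn_functional R (hnorm (ip n \<omega>)) (Fh n \<omega>) (Fh' n \<omega>) (\<alpha> (Suc k))
               (gn_iterate B R (hnorm (ip n \<omega>)) (Fh n \<omega>) (Fh' n \<omega>) \<alpha> \<phi>0 k))
            (\<lambda>\<psi>. \<psi> \<in> B) \<psi>"
    and alpha_0: "\<And>n. noise_level \<Lambda> (\<delta> n) (\<gamma> n) < \<alpha> 0"
    and alpha_q: "\<And>k. \<alpha> k \<le> q * \<alpha> (Suc k)"
    and stop: "\<And>n. \<alpha> (Suc (K n)) \<le> noise_level \<Lambda> (\<delta> n) (\<gamma> n)"
    and stop_least: "\<And>n k. k < K n \<Longrightarrow> noise_level \<Lambda> (\<delta> n) (\<gamma> n) < \<alpha> (Suc k)"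
    and initial_dom: "\<forall>\<^sub>F n in sequentially. K n = 0 \<longrightarrow> R \<phi>0 \<noteq> \<infinity>"
  shows "stoch_bounded P
      (\<lambda>n \<omega>. bregman R (sg \<phi>d)
         (gn_iterate B R (hnorm (ip n \<omega>)) (Fh n \<omega>) (Fh' n \<omega>) \<alpha> \<phi>0 (K n)) \<phi>d)
      (\<lambda>n. (\<Lambda> (noise_level \<Lambda> (\<delta> n) (\<gamma> n)))\<^sup>2)"
proof -
  define N where "N n = noise_level \<Lambda> (\<delta> n) (\<gamma> n)" for n
  define it where "it n \<omega> = gn_iterate B R (hnorm (ip n \<omega>)) (Fh n \<omega>) (Fh' n \<omega>) \<alpha> \<phi>0" for n \<omega>
  interpret source_function \<Lambda>
    using Lambda Lambda_mono by unfold_locales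
  \<comment> \<open>Half of the gap left by the contraction condition.\<close>
  define \<epsilon> where "\<epsilon> = (1 - \<eta> - 2 * \<eta> * q) / 2"
  have eps: "0 < \<epsilon>"
    using contraction_condition[OF q eta] by (simp add: \<epsilon>_def)
  have eps': "2 * \<eta> * q + 2 * \<epsilon> \<le> 1 - \<eta>"
  proof -
    have "2 * \<epsilon> = 1 - \<eta> - 2 * \<eta> * q"
      by (simp only: \<epsilon>_def) (simp add: field_simps)
    then show ?thesis by simp
  qed
  have alpha0: "0 < \<Lambda> (\<alpha> 0 / q)" "0 < Theta \<Lambda> (\<alpha> 0)"
    using alpha(1)[of 0] q by (auto intro!: pos Theta_pos)
  have Npos: "0 < N n" for n
    using alpha(1)[of "Suc (K n)"] stop[of n] by (simp add: N_def)
  \<comment> \<open>The stopping rule looks at the parameter with index \<open>K n + 1\<close>, so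
    minimality is applied to \<open>k - 1\<close>; index 0 is covered by
    \<open>alpha_0\<close>.\<close>
  have level: "N n \<le> \<alpha> k" if "k \<le> K n" for n k
    using that alpha_0[of n] stop_least[of "k - 1" n] by (cases k) (auto simp: N_def less_imp_le)
  \<comment> \<open>Converse comparison: the last parameter used exceeds the noise level by at most
    a factor \<open>q\<close>.\<close>
  have alpha_K: "\<alpha> (K n) \<le> q * N n" for n
  proof -
    have "q * \<alpha> (Suc (K n)) \<le> q * N n"
      unfolding N_def using stop[of n] q by (intro mult_left_mono) auto
    with alpha_q[of "K n"] show ?thesis by simp
  qed
  show ?thesis
    unfolding stoch_bounded_def
  proof (intro allI impI)
    fix e :: real
    assume e: "0 < e"
    \<comment> \<open>Four exceptional events share the probability \<open>e\<close>: the failures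
      of (a), (b), (c) and of the bound on the initial residual.\<close>
    then have e4: "0 < e / 4" by simp
    obtain Ma where Ma: "\<forall>\<^sub>F n in sequentially. outer_measure_of P {\<omega> \<in> space P.
        ereal (Ma * \<delta> n) < \<bar>ereal (hnorm (ip n \<omega>) (Fh n \<omega> \<phi>d))\<bar>} \<le> ennreal (e / 4)"
      using conv_a e4 unfolding stoch_bounded_def by blast
    define Sb where "Sb n \<omega> = sqrt (real_of_ereal \<bar>SUP \<phi>\<in>{\<phi>\<in>B. bregman R (sg \<phi>d) \<phi> \<phi>d \<noteq> 0}.
        ereal ((norm (F' \<phi>d (\<phi> - \<phi>d)))\<^sup>2 - (hnorm (ip n \<omega>) (Fh' n \<omega> \<phi>d (\<phi> - \<phi>d)))\<^sup>2)
          / bregman R (sg \<phi>d) \<phi> \<phi>d\<bar>)" for n \<omega>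
    obtain Mb where Mb: "\<forall>\<^sub>F n in sequentially. outer_measure_of P {\<omega> \<in> space P.
        ereal (Mb * \<gamma> n) < \<bar>ereal (Sb n \<omega>)\<bar>} \<le> ennreal (e / 4)"
      using conv_b e4 unfolding stoch_bounded_def Sb_def by blast
    obtain Mi where Mi: "\<forall>\<^sub>F n in sequentially. outer_measure_of P {\<omega> \<in> space P.
        ereal (Mi * 1) < \<bar>ereal (hnorm (ip n \<omega>) (Fh n \<omega> \<phi>0))\<bar>} \<le> ennreal (e / 4)"
      using approx_initial e4 unfolding stoch_bounded_def by blast
    define Bad where "Bad n = {\<omega> \<in> space P. \<exists>\<phi>1\<in>B. \<exists>\<phi>2\<in>B.
        \<eta> * hnorm (ip n \<omega>) (Fh n \<omega> \<phi>1 - Fh n \<omega> \<phi>2)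
          < hnorm (ip n \<omega>) (Fh n \<omega> \<phi>1 - Fh n \<omega> \<phi>2 - Fh' n \<omega> \<phi>2 (\<phi>1 - \<phi>2))}" for n
    have Mc: "\<forall>\<^sub>F n in sequentially. outer_measure_of P (Bad n) \<le> ennreal (e / 4)"
      using order_tendstoD(2)[OF conv_c, of "ennreal (e / 4)"] e4
      by (auto simp: Bad_def elim!: eventually_mono)
    define M where "M = max 0 (max Ma Mb)"
    define b where "b = \<bar>\<beta>\<bar>"
    \<comment> \<open>The first entry makes the induction step work, the second bounds the initial
      residual.\<close>
    define E where "E = max ((2 * M + b * (1 + M) + b * (1 + \<eta>) / (2 * \<epsilon>)) / \<epsilon>)
      (\<bar>Mi\<bar> / Theta \<Lambda> (\<alpha> 0) + M)"
    define C where
      "C = 2 * (\<eta> * (q * E) + M)\<^sup>2 + 2 * b * (1 + \<eta>) * E + (b * (1 + M))\<^sup>2"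
    \<comment> \<open>Constant for runs that stop at index 0; it depends neither on \<open>n\<close>
      nor on the realization.\<close>
    define C0 where "C0 = \<bar>real_of_ereal (bregman R (sg \<phi>d) \<phi>0 \<phi>d)\<bar> / (\<Lambda> (\<alpha> 0 / q))\<^sup>2"
    have M: "0 \<le> M" "Ma \<le> M" "Mb \<le> M" "0 \<le> b"
      by (auto simp: M_def b_def)
    have E: "0 \<le> E"
      using M alpha0 by (auto simp: E_def le_max_iff_disj)
    have C: "0 \<le> C" "0 \<le> C0"
      using M E eta by (auto simp: C_def C0_def simp del: abs_real_of_ereal)
    \<comment> \<open>Off the four events the estimate is deterministic.\<close>
    have bound: "\<bar>bregman R (sg \<phi>d) (it n \<omega> (K n)) \<phi>d\<bar> \<le> ereal (max (C * q) C0 * (\<Lambda> (N n))\<^sup>2)"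
      if \<omega>: "\<omega> \<in> space P" and dom: "K n = 0 \<longrightarrow> R \<phi>0 \<noteq> \<infinity>"
        and a: "\<bar>hnorm (ip n \<omega>) (Fh n \<omega> \<phi>d)\<bar> \<le> Ma * \<delta> n"
        and b: "\<bar>Sb n \<omega>\<bar> \<le> Mb * \<gamma> n"
        and i: "\<bar>hnorm (ip n \<omega>) (Fh n \<omega> \<phi>0)\<bar> \<le> Mi"
        and c: "\<omega> \<notin> Bad n" for n \<omega>
    proof -
      interpret tangential_cone B "H n \<omega>" "ip n \<omega>" "Fh n \<omega>" "Fh' n \<omega>" \<eta>
        using \<omega> c hilbert Fh_range Fh'_range eta(1)
        by unfold_locales (auto simp: Bad_def not_less)
      have \<Delta>_nonneg: "0 \<le> bregman R (sg \<phi>d) \<phi> \<phi>d" if "\<phi> \<in> B" for \<phi>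
        using bregman_nonneg[OF _ _ subgrad_dagger B(2) that] penalty
        by (auto simp: proper_convex_lsc_def)
      interpret gauss_newton B "H n \<omega>" "ip n \<omega>" "Fh n \<omega>" "Fh' n \<omega>" \<eta> \<Lambda> R "sg \<phi>d"
        "F' \<phi>d" \<phi>d b M "\<delta> n" "\<gamma> n"
      proof unfold_locales
        show "\<phi>d \<in> B" by fact
        show "R x \<noteq> - \<infinity>" if "x \<in> B" for x
          using penalty that by (simp add: proper_convex_lsc_def)
        show "\<exists>x\<in>B. R x \<noteq> \<infinity>"
          using penalty by (simp add: proper_convex_lsc_def)
        show "sg \<phi>d \<in> subdifferential B R \<phi>d" by fact
        show "0 \<le> b" "0 \<le> M" by fact+
        show "blinfun_apply (sg \<phi>d) (\<phi>d - y) \<le> b * sqrt (real_of_ereal (bregman R (sg \<phi>d) y \<phi>d))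
            * \<Lambda> ((norm (F' \<phi>d (y - \<phi>d)))\<^sup>2 / real_of_ereal (bregman R (sg \<phi>d) y \<phi>d))"
          if y: "y \<in> B" "R y \<noteq> \<infinity>" for y
        proof -
          let ?r = "real_of_ereal (bregman R (sg \<phi>d) y \<phi>d)"
          have r: "0 \<le> ?r"
            using \<Delta>_nonneg[OF y(1)] by (rule real_of_ereal_pos)
          \<comment> \<open>\<open>\<beta>\<close> may be negative; its absolute value serves as
            well because the other factor is nonnegative.\<close>
          have "\<beta> * (sqrt ?r * \<Lambda> ((norm (F' \<phi>d (y - \<phi>d)))\<^sup>2 / ?r))
              \<le> b * (sqrt ?r * \<Lambda> ((norm (F' \<phi>d (y - \<phi>d)))\<^sup>2 / ?r))"
            unfolding b_def using r by (intro mult_right_mono mult_nonneg_nonneg nonneg) auto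
          with source_condition[OF y] show ?thesis
            by (simp add: mult.assoc)
        qed
        show "hnorm (ip n \<omega>) (Fh n \<omega> \<phi>d) \<le> M * \<delta> n"
          using a mult_right_mono[OF M(2) rates(1)[of n]] by linarith
        show "(norm (F' \<phi>d (y - \<phi>d)))\<^sup>2 \<le> (hnorm (ip n \<omega>) (Fh' n \<omega> \<phi>d (y - \<phi>d)))\<^sup>2
            + (M * \<gamma> n)\<^sup>2 * real_of_ereal (bregman R (sg \<phi>d) y \<phi>d)"
          if y: "y \<in> B" "R y \<noteq> \<infinity>" "bregman R (sg \<phi>d) y \<phi>d \<noteq> 0" for y
        proof -
          let ?S = "{\<phi> \<in> B. bregman R (sg \<phi>d) \<phi> \<phi>d \<noteq> 0}"
          let ?r = "real_of_ereal (bregman R (sg \<phi>d) y \<phi>d)"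
          have fin: "(SUP \<phi>\<in>?S. ereal ((norm (F' \<phi>d (\<phi> - \<phi>d)))\<^sup>2) / bregman R (sg \<phi>d) \<phi> \<phi>d) < \<infinity>"
            using F_bounded B(2) subgrad_dagger by (auto simp: bregman_bounded_on_def)
          have eq: "bregman R (sg \<phi>d) y \<phi>d = ereal ?r"
            using bregman_real[OF _ _ subgrad_dagger B(2) y(1,2)] penalty
            by (auto simp: proper_convex_lsc_def)
          have "(norm (F' \<phi>d (y - \<phi>d)))\<^sup>2 \<le> (hnorm (ip n \<omega>) (Fh' n \<omega> \<phi>d (y - \<phi>d)))\<^sup>2 + (Mb * \<gamma> n)\<^sup>2 * ?r"
            by (rule le_of_sup_quotient_diff[OF fin _ _ _ _ eq])
              (use b \<Delta>_nonneg y in \<open>auto simp: Sb_def less_le\<close>)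
          also have "(Mb * \<gamma> n)\<^sup>2 * ?r \<le> (M * \<gamma> n)\<^sup>2 * ?r"
          proof (rule mult_right_mono[OF power_mono])
            show "Mb * \<gamma> n \<le> M * \<gamma> n"
              using M(3) rates(2)[of n] by (intro mult_right_mono)
            show "0 \<le> Mb * \<gamma> n"
              using b by simp
            show "0 \<le> ?r"
              using \<Delta>_nonneg[OF y(1)] by (rule real_of_ereal_pos)
          qed
          finally show ?thesis by simp
        qed
      qed
      have level_\<delta>\<gamma>: "\<delta> n \<le> Theta \<Lambda> (\<alpha> k)" "(\<gamma> n)\<^sup>2 \<le> \<alpha> k" if "k \<le> K n" for k
        using noise_level_bounds[OF rates(1)[of n]] level[OF that] by (auto simp: N_def)
      have start: "it n \<omega> 0 \<in> B"
          "hnorm (ip n \<omega>) (Fh n \<omega> (it n \<omega> 0) - Fh n \<omega> \<phi>d) \<le> E * Theta \<Lambda> (\<alpha> 0)"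
      proof -
        show "it n \<omega> 0 \<in> B"
          using B by (simp add: it_def)
        have "hnorm (ip n \<omega>) (Fh n \<omega> \<phi>0 - Fh n \<omega> \<phi>d)
            \<le> hnorm (ip n \<omega>) (Fh n \<omega> \<phi>0) + hnorm (ip n \<omega>) (Fh n \<omega> \<phi>d)"
          using hnorm_triangle_ineq[OF hilbert, of "Fh n \<omega> \<phi>0" "- Fh n \<omega> \<phi>d"]
            hnorm_minus[OF hilbert, of "Fh n \<omega> \<phi>d"] subspace_neg[OF subspace_H]
            G_mem[OF B(2)] G_mem[OF B(3)] by simp
        also have "\<dots> \<le> \<bar>Mi\<bar> + M * Theta \<Lambda> (\<alpha> 0)"
          using i noise mult_left_mono[OF level_\<delta>\<gamma>(1)[of 0] M(1)] by simp
        also have "\<dots> = (\<bar>Mi\<bar> / Theta \<Lambda> (\<alpha> 0) + M) * Theta \<Lambda> (\<alpha> 0)"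
          using alpha0 by (simp add: field_simps)
        also have "\<dots> \<le> E * Theta \<Lambda> (\<alpha> 0)"
          using alpha0 by (intro mult_right_mono) (auto simp: E_def)
        finally show "hnorm (ip n \<omega>) (Fh n \<omega> (it n \<omega> 0) - Fh n \<omega> \<phi>d) \<le> E * Theta \<Lambda> (\<alpha> 0)"
          by (simp add: it_def)
      qed
      \<comment> \<open>\<open>arg_min_on\<close> is a choice operator, so solvability is what makes
        the iterates minimizers.\<close>
      have min: "is_arg_min (gn_functional R (hnorm (ip n \<omega>)) (Fh n \<omega>) (Fh' n \<omega>) (\<alpha> (Suc k))
          (it n \<omega> k)) (\<lambda>z. z \<in> B) (it n \<omega> (Suc k))" for k
        using someI_ex[OF ex1_implies_ex[OF well_defined[OF \<omega>, of n k]]]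
        by (simp add: it_def arg_min_on_def arg_min_def)
      note iter = iteration[OF start min alpha(1) alpha_q level_\<delta>\<gamma> less_imp_le[OF q] eps eps', of "K n" "K n",
          folded C_def]
      show ?thesis
      \<comment> \<open>An iteration stopped at once is no minimizer, but then the noise level is bounded away from 0.\<close>
      proof (cases "K n = 0")
        case True
        then have fin: "R \<phi>0 \<noteq> \<infinity>"
          using dom by simp
        have "\<alpha> 0 / q \<le> N n"
          using alpha_K[of n] True q by (simp add: pos_divide_le_eq mult.commute)
        then have "\<Lambda> (\<alpha> 0 / q) \<le> \<Lambda> (N n)"
          using alpha(1)[of 0] q by (intro mono) auto
        then have "(\<Lambda> (\<alpha> 0 / q))\<^sup>2 \<le> (\<Lambda> (N n))\<^sup>2"
          using alpha0 by (intro power_mono) auto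
        then have "C0 * (\<Lambda> (\<alpha> 0 / q))\<^sup>2 \<le> C0 * (\<Lambda> (N n))\<^sup>2"
          using C by (intro mult_left_mono)
        moreover have "\<bar>\<Delta> \<phi>0\<bar> = C0 * (\<Lambda> (\<alpha> 0 / q))\<^sup>2"
          using alpha0 by (simp add: C0_def \<Delta>_def)
        moreover have "C0 * (\<Lambda> (N n))\<^sup>2 \<le> max (C * q) C0 * (\<Lambda> (N n))\<^sup>2"
          by (intro mult_right_mono) auto
        ultimately show ?thesis
          using bregman_finite(1)[OF B(3) fin] True by (simp add: it_def)
      next
        case False
        have fin: "it n \<omega> (K n) \<in> B" "R (it n \<omega> (K n)) \<noteq> \<infinity>"
            and \<Delta>_le: "\<Delta> (it n \<omega> (K n)) \<le> C * (\<Lambda> (\<alpha> (K n)))\<^sup>2"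
          using iter False by (auto simp: E_def)
        \<comment> \<open>Passing from the last parameter to the noise level costs
          \<open>sqrt q\<close>, which explains the factor \<open>q\<close> in
          \<open>C * q\<close>.\<close>
        have "\<Lambda> (\<alpha> (K n)) \<le> \<Lambda> (q * N n)"
          using alpha_K[of n] alpha(1)[of "K n"] by (intro mono) auto
        also have "\<dots> \<le> sqrt q * \<Lambda> (N n)"
          using le_sqrt_ratio[of "N n" "q * N n"] Npos[of n] q by simp
        finally have "(\<Lambda> (\<alpha> (K n)))\<^sup>2 \<le> (sqrt q * \<Lambda> (N n))\<^sup>2"
          using nonneg[of "\<alpha> (K n)"] alpha(1)[of "K n"] by (intro power_mono) auto
        then have "C * (\<Lambda> (\<alpha> (K n)))\<^sup>2 \<le> C * (q * (\<Lambda> (N n))\<^sup>2)"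
          using C q by (intro mult_left_mono) (auto simp: power_mult_distrib)
        moreover have "C * q * (\<Lambda> (N n))\<^sup>2 \<le> max (C * q) C0 * (\<Lambda> (N n))\<^sup>2"
          by (intro mult_right_mono) auto
        ultimately show ?thesis
          using bregman_finite[OF fin] \<Delta>_le by (simp add: mult.assoc)
      qed
    qed
    have "\<forall>\<^sub>F n in sequentially. outer_measure_of P {\<omega> \<in> space P.
        ereal (max (C * q) C0 * (\<Lambda> (N n))\<^sup>2) < \<bar>bregman R (sg \<phi>d) (it n \<omega> (K n)) \<phi>d\<bar>} \<le> ennreal e"
      using Ma Mb Mi Mc initial_dom
    proof eventually_elim
      case (elim n)
      let ?A = "{\<omega> \<in> space P. ereal (Ma * \<delta> n) < \<bar>ereal (hnorm (ip n \<omega>) (Fh n \<omega> \<phi>d))\<bar>}"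
      let ?B = "{\<omega> \<in> space P. ereal (Mb * \<gamma> n) < \<bar>ereal (Sb n \<omega>)\<bar>}"
      let ?I = "{\<omega> \<in> space P. ereal (Mi * 1) < \<bar>ereal (hnorm (ip n \<omega>) (Fh n \<omega> \<phi>0))\<bar>}"
      let ?X = "{\<omega> \<in> space P. ereal (max (C * q) C0 * (\<Lambda> (N n))\<^sup>2)
        < \<bar>bregman R (sg \<phi>d) (it n \<omega> (K n)) \<phi>d\<bar>}"
      \<comment> \<open>Contrapositive of \<open>bound\<close>.\<close>
      have "?X \<subseteq> (?A \<union> ?B) \<union> (?I \<union> Bad n)"
        using bound[of _ n] elim(5) by (force simp: not_less[symmetric])
      then have "outer_measure_of P ?X \<le> outer_measure_of P ((?A \<union> ?B) \<union> (?I \<union> Bad n))"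
        by (rule outer_measure_of_mono)
      also have "\<dots> \<le> outer_measure_of P (?A \<union> ?B) + outer_measure_of P (?I \<union> Bad n)"
        by (intro outer_measure_of_Un_le) (auto simp: Bad_def)
      also have "\<dots> \<le> (outer_measure_of P ?A + outer_measure_of P ?B)
          + (outer_measure_of P ?I + outer_measure_of P (Bad n))"
        by (intro add_mono outer_measure_of_Un_le) (auto simp: Bad_def)
      also have "\<dots> \<le> (ennreal (e / 4) + ennreal (e / 4)) + (ennreal (e / 4) + ennreal (e / 4))"
        using elim by (intro add_mono)
      also have "\<dots> = ennreal e"
        using e by (simp flip: ennreal_plus)
      finally show ?case .
    qed
    then show "\<exists>M. \<forall>\<^sub>F n in sequentially. outer_measure_of P {\<omega> \<in> space P.
        ereal (M * (\<Lambda> (noise_level \<Lambda> (\<delta> n) (\<gamma> n)))\<^sup>2) < \<bar>bregman R (sg \<phi>d)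
          (gn_iterate B R (hnorm (ip n \<omega>)) (Fh n \<omega>) (Fh' n \<omega>) \<alpha> \<phi>0 (K n)) \<phi>d\<bar>} \<le> ennreal e"
      unfolding it_def N_def by blast
  qed
qed

end
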